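(* Let $(\Omega^\bullet,d)$ be a differential calculus on an algebra $A$, let $V$ be a vector space of derivations on $A$, closed under commutator, for which the interior products and Lie derivatives are well defined, and let $\omega\in\Omega^2$ be closed and nonsingular. If $a,b,c\in A$ are Hamiltonian, then $$\{c,\{a,b\}\}+\{b,\{c,a\}\}+\{a,\{b,c\}\}=0,$$ i.e. the Poisson bracket satisfies the Jacobi identity.
   Context: $A$ is an associative unital (not necessarily commutative) algebra over a field. A differential calculus on $A$ is a collection of $A$-bimodules $\Omega^n$, $n\ge 0$, with $\Omega^0=A$, with an associative graded product $\Omega^n\times\Omega^m\to\Omega^{n+m}$ extending the bimodule structure, and with a linear signed derivation $d:\Omega^n\to\Omega^{n+1}$, i.e. $d(\omega\tau)=d(\omega)\,\tau+(-1)^{|\omega|}\omega\,d(\tau)$ (where $|\omega|=n$ if $\omega\in\Omega^n$), such that $d^2=0$ and $\Omega^{n+1}$ is spanned by the elements $\omega\,db$ with $\omega\in\Omega^n$, $b\in A$. Everything is purely algebraic (no topology). $V$ is a vector space of linear maps $\theta:A\to A$ with $\theta(ab)=\theta(a)b+a\theta(b)$, closed under the commutator $[\theta,\phi]=\theta\phi-\phi\theta$. Interior product: for $\theta\in V$, $\theta\lrcorner:\Omega^{n+1}\to\Omega^n$ is the linear map determined by $\theta\lrcorner a=0$ for $a\in\Omega^0=A$, $\theta\lrcorner da=\theta(a)$, and $\theta\lrcorner(\omega\tau)=(\theta\lrcorner\,\omega)\tau+(-1)^{|\omega|}\omega(\theta\lrcorner\tau)$. Lie derivative: for $\theta\in V$,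 ${\cal L}_\theta:\Omega^n\to\Omega^n$ is the linear map determined by ${\cal L}_\theta(a)=\theta(a)$ for $a\in\Omega^0=A$, ${\cal L}_\theta(da)=d(\theta(a))$, and ${\cal L}_\theta(\omega\tau)={\cal L}_\theta(\omega)\tau+\omega{\cal L}_\theta(\tau)$. Standing assumption: for every $\theta\in V$ the maps $\theta\lrcorner$ and ${\cal L}_\theta$ are well defined on all of $\Omega^\bullet$ (i.e. compatible with all relations in the calculus). Fix $\omega\in\Omega^2$ with $d\omega=0$ (closed). Let $V^\omega=\{\theta\in V:{\cal L}_\theta(\omega)=0\}$, let $Z^1=\{\eta\in\Omega^1: d\eta=0\}$, and define $\tilde\omega:V^\omega\to Z^1$ by $\tilde\omega(\theta)=\theta\lrcorner\,\omega$ (for $\theta\in V$ one has ${\cal L}_\theta(\omega)=0$ if and only if $d(\theta\lrcorner\,\omega)=0$). The form $\omega$ is nonsingular if $\tilde\omega$ is injective. An element $a\in A$ is Hamiltonian if $da$ is in the image of $\tilde\omega$; then $X_a\in V^\omega$ denotes the unique element with $\tilde\omega(X_a)=da$. For Hamiltonian $a,b$ the Poisson bracket is $\{a,b\}=X_a\lrcorner(db)=X_a(b)\in A$. The Poisson bracket of two Hamiltonian elements is again Hamiltonian, so iterated brackets are defined. *)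

theory Defs
  imports Complex_Main
begin

text \<open>
  Associative unital algebras are types of sort \<open>{ring, monoid_mult}\<close> with an explicit
  scalar multiplication; unlike \<open>ring_1\<close>, this sort does not exclude the zero algebra.
\<close>

locale unital_algebra = vector_space scale
  for scale :: "'k::field \<Rightarrow> 'a::{ring, monoid_mult} \<Rightarrow> 'a" +
  assumes scale_mult_left: "scale c (x * y) = scale c x * y"
    and scale_mult_right: "scale c (x * y) = x * scale c y"

text \<open>
  The collection \<open>\<Omega>\<^sup>n\<close> is encoded by its total algebra, the direct sum of all
  \<open>\<Omega>\<^sup>n\<close>, which is the type \<open>'w\<close>; \<open>forms C n\<close> is \<open>\<Omega>\<^sup>n\<close>.
  The equality \<open>\<Omega>\<^sup>0 = A\<close> is the identification of the type \<open>'a\<close> with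
  \<open>forms C 0\<close> along \<open>emb C\<close>, and the bimodule actions are multiplication by
  \<open>emb C a\<close> on either side.
\<close>

record ('k, 'a, 'w) calculus =
  scA :: "'k \<Rightarrow> 'a \<Rightarrow> 'a"
  scW :: "'k \<Rightarrow> 'w \<Rightarrow> 'w"
  forms :: "nat \<Rightarrow> 'w set"
  emb :: "'a \<Rightarrow> 'w"
  diff :: "'w \<Rightarrow> 'w"

locale differential_calculus =
  A: unital_algebra "scA C" + W: unital_algebra "scW C"
  for C :: "('k::field, 'a::{ring, monoid_mult}, 'w::{ring, monoid_mult}) calculus" +
  assumes forms_subspace: "W.subspace (forms C n)"
    and forms_direct_sum:
      "\<exists>!f. (\<forall>n. f n \<in> forms C n) \<and> finite {n. f n \<noteq> 0} \<and> x = (\<Sum>n | f n \<noteq> 0. f n)"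
    and forms_mult: "\<xi> \<in> forms C n \<Longrightarrow> \<tau> \<in> forms C m \<Longrightarrow> \<xi> * \<tau> \<in> forms C (n + m)"
    and emb_linear: "Vector_Spaces.linear (scA C) (scW C) (emb C)"
    and emb_mult: "emb C (a * b) = emb C a * emb C b"
    and emb_one: "emb C 1 = 1"
    and emb_bij: "bij_betw (emb C) UNIV (forms C 0)"
    and diff_linear: "Vector_Spaces.linear (scW C) (scW C) (diff C)"
    and diff_forms: "\<xi> \<in> forms C n \<Longrightarrow> diff C \<xi> \<in> forms C (n + 1)"
    and diff_mult: "\<xi> \<in> forms C n \<Longrightarrow> \<tau> \<in> forms C m \<Longrightarrow>
      diff C (\<xi> * \<tau>) = diff C \<xi> * \<tau> + (- 1) ^ n * \<xi> * diff C \<tau>"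
    and diff_diff: "\<xi> \<in> forms C n \<Longrightarrow> diff C (diff C \<xi>) = 0"
    and forms_span:
      "forms C (n + 1) = W.span {\<xi> * diff C (emb C b) | \<xi> b. \<xi> \<in> forms C n}"

definition derivation :: "('k::field, 'a::{ring, monoid_mult}, 'w) calculus \<Rightarrow> ('a \<Rightarrow> 'a) \<Rightarrow> bool"
  where "derivation C \<theta> \<longleftrightarrow>
    Vector_Spaces.linear (scA C) (scA C) \<theta> \<and> (\<forall>a b. \<theta> (a * b) = \<theta> a * b + a * \<theta> b)"

definition derivation_lie_algebra ::
  "('k::field, 'a::{ring, monoid_mult}, 'w) calculus \<Rightarrow> ('a \<Rightarrow> 'a) set \<Rightarrow> bool"
  where "derivation_lie_algebra C V \<longleftrightarrow>
    (\<forall>\<theta>\<in>V. derivation C \<theta>) \<and>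
    (\<lambda>a. 0) \<in> V \<and>
    (\<forall>\<theta>\<in>V. \<forall>\<phi>\<in>V. (\<lambda>a. \<theta> a + \<phi> a) \<in> V) \<and>
    (\<forall>k. \<forall>\<theta>\<in>V. (\<lambda>a. scA C k (\<theta> a)) \<in> V) \<and>
    (\<forall>\<theta>\<in>V. \<forall>\<phi>\<in>V. (\<lambda>a. \<theta> (\<phi> a) - \<phi> (\<theta> a)) \<in> V)"

definition is_interior_product ::
  "('k::field, 'a, 'w::{ring, monoid_mult}) calculus \<Rightarrow> ('a \<Rightarrow> 'a) \<Rightarrow> ('w \<Rightarrow> 'w) \<Rightarrow> bool"
  where "is_interior_product C \<theta> i \<longleftrightarrow>
    Vector_Spaces.linear (scW C) (scW C) i \<and>
    (\<forall>n. i ` forms C (n + 1) \<subseteq> forms C n) \<and>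
    (\<forall>a. i (emb C a) = 0) \<and>
    (\<forall>a. i (diff C (emb C a)) = emb C (\<theta> a)) \<and>
    (\<forall>n m. \<forall>\<xi>\<in>forms C n. \<forall>\<tau>\<in>forms C m. i (\<xi> * \<tau>) = i \<xi> * \<tau> + (- 1) ^ n * \<xi> * i \<tau>)"

definition is_lie_derivative ::
  "('k::field, 'a, 'w::{ring, monoid_mult}) calculus \<Rightarrow> ('a \<Rightarrow> 'a) \<Rightarrow> ('w \<Rightarrow> 'w) \<Rightarrow> bool"
  where "is_lie_derivative C \<theta> L \<longleftrightarrow>
    Vector_Spaces.linear (scW C) (scW C) L \<and>
    (\<forall>n. L ` forms C n \<subseteq> forms C n) \<and>
    (\<forall>a. L (emb C a) = emb C (\<theta> a)) \<and>
    (\<forall>a. L (diff C (emb C a)) = diff C (emb C (\<theta> a))) \<and>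
    (\<forall>n m. \<forall>\<xi>\<in>forms C n. \<forall>\<tau>\<in>forms C m. L (\<xi> * \<tau>) = L \<xi> * \<tau> + \<xi> * L \<tau>)"

text \<open>
  In a differential calculus each of the two predicates above has at most one solution, because
  the forms are spanned by products of elements of \<open>A\<close> and their differentials. Hence
  "well defined" means that a solution exists.
\<close>

definition interior_well_defined ::
  "('k::field, 'a, 'w::{ring, monoid_mult}) calculus \<Rightarrow> ('a \<Rightarrow> 'a) \<Rightarrow> bool"
  where "interior_well_defined C \<theta> \<longleftrightarrow> (\<exists>i. is_interior_product C \<theta> i)"

definition lie_well_defined ::
  "('k::field, 'a, 'w::{ring, monoid_mult}) calculus \<Rightarrow> ('a \<Rightarrow> 'a) \<Rightarrow> bool"
  where "lie_well_defined C \<theta> \<longleftrightarrow> (\<exists>L. is_lie_derivative C \<theta> L)"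

definition interior_product ::
  "('k::field, 'a, 'w::{ring, monoid_mult}) calculus \<Rightarrow> ('a \<Rightarrow> 'a) \<Rightarrow> 'w \<Rightarrow> 'w"
  where "interior_product C \<theta> = (THE i. is_interior_product C \<theta> i)"

definition lie_derivative ::
  "('k::field, 'a, 'w::{ring, monoid_mult}) calculus \<Rightarrow> ('a \<Rightarrow> 'a) \<Rightarrow> 'w \<Rightarrow> 'w"
  where "lie_derivative C \<theta> = (THE L. is_lie_derivative C \<theta> L)"

definition invariant_fields ::
  "('k::field, 'a, 'w::{ring, monoid_mult}) calculus \<Rightarrow> ('a \<Rightarrow> 'a) set \<Rightarrow> 'w \<Rightarrow> ('a \<Rightarrow> 'a) set"
  where "invariant_fields C V \<omega> = {\<theta> \<in> V. lie_derivative C \<theta> \<omega> = 0}"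

definition omega_tilde ::
  "('k::field, 'a, 'w::{ring, monoid_mult}) calculus \<Rightarrow> 'w \<Rightarrow> ('a \<Rightarrow> 'a) \<Rightarrow> 'w"
  where "omega_tilde C \<omega> \<theta> = interior_product C \<theta> \<omega>"

definition nonsingular ::
  "('k::field, 'a, 'w::{ring, monoid_mult}) calculus \<Rightarrow> ('a \<Rightarrow> 'a) set \<Rightarrow> 'w \<Rightarrow> bool"
  where "nonsingular C V \<omega> \<longleftrightarrow> inj_on (omega_tilde C \<omega>) (invariant_fields C V \<omega>)"

definition hamiltonian ::
  "('k::field, 'a, 'w::{ring, monoid_mult}) calculus \<Rightarrow> ('a \<Rightarrow> 'a) set \<Rightarrow> 'w \<Rightarrow> 'a \<Rightarrow> bool"
  where "hamiltonian C V \<omega> a \<longleftrightarrow>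
    diff C (emb C a) \<in> omega_tilde C \<omega> ` invariant_fields C V \<omega>"

definition hamiltonian_field ::
  "('k::field, 'a, 'w::{ring, monoid_mult}) calculus \<Rightarrow> ('a \<Rightarrow> 'a) set \<Rightarrow> 'w \<Rightarrow> 'a \<Rightarrow> 'a \<Rightarrow> 'a"
  where "hamiltonian_field C V \<omega> a =
    (THE \<theta>. \<theta> \<in> invariant_fields C V \<omega> \<and> omega_tilde C \<omega> \<theta> = diff C (emb C a))"

text \<open>
  The bracket \<open>{a, b} = X\<^sub>a \<lrcorner> db = X\<^sub>a(b)\<close>, taken in the second form because it is an
  element of the type \<open>'a\<close>; the first form is \<open>emb C (poisson_bracket C V \<omega> a b)\<close>.
\<close>

definition poisson_bracket ::
  "('k::field, 'a, 'w::{ring, monoid_mult}) calculus \<Rightarrow> ('a \<Rightarrow> 'a) set \<Rightarrow> 'w \<Rightarrow> 'a \<Rightarrow> 'a \<Rightarrow> 'a"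
  where "poisson_bracket C V \<omega> a b = hamiltonian_field C V \<omega> a b"

end

theory Submission
  imports Defs
begin

text \<open>
  A graded derivation of \<open>\<Omega>\<close> is determined by its values on \<open>A\<close> and \<open>dA\<close>, and the graded
  commutator of two graded derivations is one again. This yields the Cartan identities
  \<open>L\<^sub>\<theta> = di\<^sub>\<theta> + i\<^sub>\<theta>d\<close>, \<open>i\<^sub>\<theta>i\<^sub>\<phi> + i\<^sub>\<phi>i\<^sub>\<theta> = 0\<close> and \<open>L\<^sub>\<theta>i\<^sub>\<phi> - i\<^sub>\<phi>L\<^sub>\<theta> = i\<^bsub>[\<theta>,\<phi>]\<^esub>\<close>.
  The second makes the Poisson bracket antisymmetric, and the other two give
  \<open>X\<^bsub>{a,b}\<^esub> = [X\<^sub>a, X\<^sub>b]\<close>; the Jacobi identity is these two statements combined.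
\<close>

text \<open>Turns sign identities into case distinctions on parities.\<close>

lemma minus_one_power_mult:
  fixes x :: "'a::{ring, monoid_mult}"
  shows "(- 1) ^ n * x = (if even n then x else - x)"
  by (induction n) (auto simp: mult.assoc)

section \<open>Graded derivations of the total algebra\<close>

context differential_calculus
begin

text \<open>The degree \<open>p\<close> enters only through the sign. No condition is put on the
  degrees of the values, since uniqueness uses only linearity and the Leibniz rule; this is all that
  has to be checked for a commutator.\<close>

definition twisted_derivation :: "nat \<Rightarrow> ('w \<Rightarrow> 'w) \<Rightarrow> bool"
  where "twisted_derivation p D \<longleftrightarrow>
    (\<forall>x y. D (x + y) = D x + D y) \<and>
    (\<forall>k x. D (scW C k x) = scW C k (D x)) \<and>
    (\<forall>n m. \<forall>\<xi>\<in>forms C n. \<forall>\<tau>\<in>forms C m. D (\<xi> * \<tau>) = D \<xi> * \<tau> + (- 1) ^ (p * n) * \<xi> * D \<tau>)"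

text \<open>
  The degree of \<open>D\<close> is recorded only modulo 2, so that one notion covers
  \<open>d\<close>, \<open>\<theta>\<lrcorner>\<close> and \<open>L\<^sub>\<theta>\<close>; the operator \<open>\<theta>\<lrcorner>\<close> satisfies it on \<open>\<Omega>\<^sup>0\<close>
  because \<open>0\<close> lies in every \<open>\<Omega>\<^sup>m\<close>.
\<close>

definition graded_derivation :: "nat \<Rightarrow> ('w \<Rightarrow> 'w) \<Rightarrow> bool"
  where "graded_derivation p D \<longleftrightarrow> twisted_derivation p D \<and>
    (\<forall>n. \<forall>\<xi>\<in>forms C n. \<exists>m. D \<xi> \<in> forms C m \<and> even (m + n + p))"

lemma twisted_derivation_add: "twisted_derivation p D \<Longrightarrow> D (x + y) = D x + D y"
  and twisted_derivation_scale: "twisted_derivation p D \<Longrightarrow> D (scW C k x) = scW C k (D x)"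
  and twisted_derivation_mult:
    "twisted_derivation p D \<Longrightarrow> \<xi> \<in> forms C n \<Longrightarrow> \<tau> \<in> forms C m \<Longrightarrow>
      D (\<xi> * \<tau>) = D \<xi> * \<tau> + (- 1) ^ (p * n) * \<xi> * D \<tau>"
  by (auto simp: twisted_derivation_def)

lemma twisted_derivation_zero: "twisted_derivation p D \<Longrightarrow> D 0 = 0"
  using twisted_derivation_add[of p D 0 0] by simp

lemma twisted_derivation_minus: "twisted_derivation p D \<Longrightarrow> D (- x) = - D x"
  using twisted_derivation_add[of p D x "- x"] twisted_derivation_zero[of p D]
  by (simp add: eq_neg_iff_add_eq_0 add.commute)

lemma twisted_derivation_sum: "twisted_derivation p D \<Longrightarrow> D (\<Sum>i\<in>I. f i) = (\<Sum>i\<in>I. D (f i))"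
  by (induction I rule: infinite_finite_induct)
    (simp_all add: twisted_derivation_zero twisted_derivation_add)

section \<open>The copy of \<open>A\<close> in degree 0, and uniqueness of derivations\<close>

lemma emb_in_forms: "emb C a \<in> forms C 0"
  using emb_bij by (auto simp: bij_betw_def)

lemma forms_0E:
  assumes "\<xi> \<in> forms C 0"
  obtains a where "\<xi> = emb C a"
  using assms emb_bij by (auto simp: bij_betw_def)

lemma emb_inj: "emb C a = emb C b \<longleftrightarrow> a = b"
  using emb_bij by (auto simp: bij_betw_def inj_on_def)

lemma diff_emb_in_forms: "diff C (emb C a) \<in> forms C 1"
  using diff_forms[OF emb_in_forms] by simp

text \<open>Induction on the degree: \<open>forms C (n + 1)\<close> is spanned by products \<zeta>
  db with \<zeta> of degree n, and the Leibniz rule, with the same sign for both maps, reduces such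
  a product to \<zeta> and db.\<close>

lemma twisted_derivation_eq_on_forms:
  assumes D: "twisted_derivation p D" and E: "twisted_derivation p E"
    and emb: "\<And>a. D (emb C a) = E (emb C a)"
    and dif: "\<And>a. D (diff C (emb C a)) = E (diff C (emb C a))"
    and \<xi>: "\<xi> \<in> forms C n"
  shows "D \<xi> = E \<xi>"
  using \<xi>
proof (induction n arbitrary: \<xi>)
  case 0
  then show ?case using emb by (auto elim: forms_0E)
next
  case (Suc n)
  have "\<xi> \<in> W.span {\<xi> * diff C (emb C b) | \<xi> b. \<xi> \<in> forms C n}"
    using Suc.prems forms_span[of n] by simp
  then show ?case
  proof (induction rule: W.span_induct_alt)
    case base
    then show ?case by (simp add: twisted_derivation_zero[OF D] twisted_derivation_zero[OF E])
  next
    case (step k x y)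
    then obtain \<zeta> b where x: "x = \<zeta> * diff C (emb C b)" and \<zeta>: "\<zeta> \<in> forms C n" by blast
    have "D x = E x"
      unfolding x twisted_derivation_mult[OF D \<zeta> diff_emb_in_forms]
        twisted_derivation_mult[OF E \<zeta> diff_emb_in_forms] dif Suc.IH[OF \<zeta>] ..
    with step show ?case
      by (simp add: twisted_derivation_add[OF D] twisted_derivation_add[OF E]
          twisted_derivation_scale[OF D] twisted_derivation_scale[OF E])
  qed
qed

lemma twisted_derivation_eqI:
  assumes D: "twisted_derivation p D" and E: "twisted_derivation p E"
    and "\<And>a. D (emb C a) = E (emb C a)"
    and "\<And>a. D (diff C (emb C a)) = E (diff C (emb C a))"
  shows "D = E"
proof
  fix x
  obtain f where f: "\<And>n. f n \<in> forms C n" and x: "x = (\<Sum>n | f n \<noteq> 0. f n)"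
    using forms_direct_sum[of x] by blast
  show "D x = E x"
    unfolding x twisted_derivation_sum[OF D] twisted_derivation_sum[OF E]
    using twisted_derivation_eq_on_forms[OF assms f] by simp
qed

section \<open>Graded commutators\<close>

lemma graded_derivationD: "graded_derivation p D \<Longrightarrow> twisted_derivation p D"
  by (simp add: graded_derivation_def)

text \<open>Two applications of the Leibniz rule. The outer one needs \<open>E \<xi>\<close> and
  \<open>E \<tau>\<close> homogeneous, and its sign depends only on the parity n + q of
  \<open>E \<xi>\<close>.\<close>

lemma twisted_derivation_comp_mult:
  assumes D: "graded_derivation p D" and E: "graded_derivation q E"
    and \<xi>: "\<xi> \<in> forms C n" and \<tau>: "\<tau> \<in> forms C m"
  shows "D (E (\<xi> * \<tau>)) = D (E \<xi>) * \<tau> + (- 1) ^ (p * (n + q)) * (E \<xi> * D \<tau>)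
    + (- 1) ^ (q * n) * (D \<xi> * E \<tau>) + (- 1) ^ ((p + q) * n) * (\<xi> * D (E \<tau>))"
proof -
  note D' = graded_derivationD[OF D] and E' = graded_derivationD[OF E]
  obtain k where k: "E \<xi> \<in> forms C k" "even (k + n + q)"
    using E \<xi> unfolding graded_derivation_def by blast
  obtain l where l: "E \<tau> \<in> forms C l"
    using E \<tau> unfolding graded_derivation_def by blast
  have "even k \<longleftrightarrow> even (n + q)" using k(2) by (simp only: even_add) blast
  then show ?thesis
    by (auto simp: twisted_derivation_mult[OF E' \<xi> \<tau>] twisted_derivation_add[OF D']
        twisted_derivation_mult[OF D' k(1) \<tau>] twisted_derivation_mult[OF D' \<xi> l]
        mult.assoc minus_one_power_mult twisted_derivation_minus[OF D'] algebra_simps)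
qed

text \<open>The sign \<open>(- 1) ^ (p * q)\<close> is the one for which the mixed products
  \<open>E \<xi> * D \<tau>\<close> and \<open>D \<xi> * E \<tau>\<close> from the two orders of
  composition cancel.\<close>

lemma twisted_derivation_commutator:
  assumes D: "graded_derivation p D" and E: "graded_derivation q E"
  shows "twisted_derivation (p + q) (\<lambda>x. D (E x) - (- 1) ^ (p * q) * E (D x))"
proof -
  note D' = graded_derivationD[OF D] and E' = graded_derivationD[OF E]
  show ?thesis
    unfolding twisted_derivation_def
  proof (intro conjI allI ballI)
    fix x y
    show "D (E (x + y)) - (- 1) ^ (p * q) * E (D (x + y))
      = D (E x) - (- 1) ^ (p * q) * E (D x) + (D (E y) - (- 1) ^ (p * q) * E (D y))"
      by (simp add: twisted_derivation_add[OF D'] twisted_derivation_add[OF E'] algebra_simps)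
  next
    fix k x
    show "D (E (scW C k x)) - (- 1) ^ (p * q) * E (D (scW C k x))
      = scW C k (D (E x) - (- 1) ^ (p * q) * E (D x))"
      by (simp add: twisted_derivation_scale[OF D'] twisted_derivation_scale[OF E']
          W.scale_right_diff_distrib W.scale_mult_right)
  next
    fix n m \<xi> \<tau> assume \<xi>: "\<xi> \<in> forms C n" and \<tau>: "\<tau> \<in> forms C m"
    show "D (E (\<xi> * \<tau>)) - (- 1) ^ (p * q) * E (D (\<xi> * \<tau>))
      = (D (E \<xi>) - (- 1) ^ (p * q) * E (D \<xi>)) * \<tau>
        + (- 1) ^ ((p + q) * n) * \<xi> * (D (E \<tau>) - (- 1) ^ (p * q) * E (D \<tau>))"
      unfolding twisted_derivation_comp_mult[OF D E \<xi> \<tau>] twisted_derivation_comp_mult[OF E D \<xi> \<tau>]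
      by (auto simp: mult.assoc minus_one_power_mult algebra_simps)
  qed
qed

section \<open>\<open>d\<close>, interior products and Lie derivatives as graded derivations\<close>

lemma graded_derivation_diff: "graded_derivation 1 (diff C)"
proof -
  interpret d: Vector_Spaces.linear "scW C" "scW C" "diff C" by (rule diff_linear)
  show ?thesis
    using diff_forms
    by (fastforce simp: graded_derivation_def twisted_derivation_def d.add d.scale diff_mult)
qed

lemma diff_twice: "diff C (diff C x) = 0"
proof -
  obtain f where f: "\<And>n. f n \<in> forms C n" and x: "x = (\<Sum>n | f n \<noteq> 0. f n)"
    using forms_direct_sum[of x] by blast
  show ?thesis
    unfolding x twisted_derivation_sum[OF graded_derivationD[OF graded_derivation_diff]]
    by (simp add: diff_diff[OF f])
qed

text \<open>The degree -1 is recorded as 1, which has the same parity.\<close>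

lemma graded_derivation_interior:
  assumes "is_interior_product C \<theta> i"
  shows "graded_derivation 1 i"
proof -
  interpret i: Vector_Spaces.linear "scW C" "scW C" i
    using assms by (simp add: is_interior_product_def)
  have "\<exists>m. i \<xi> \<in> forms C m \<and> even (m + n + 1)" if \<xi>: "\<xi> \<in> forms C n" for n \<xi>
  proof (cases n)
    case 0
    then have "i \<xi> = 0"
      using \<xi> assms by (auto simp: is_interior_product_def elim: forms_0E)
    then show ?thesis
      using 0 W.subspace_0[OF forms_subspace[of 1]] by (intro exI[of _ 1]) simp
  next
    case (Suc k)
    then show ?thesis
      using \<xi> assms by (intro exI[of _ k]) (auto simp: is_interior_product_def)
  qed
  with assms show ?thesis
    by (auto simp: graded_derivation_def twisted_derivation_def is_interior_product_def
        i.add i.scale)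
qed

lemma graded_derivation_lie:
  assumes "is_lie_derivative C \<theta> L"
  shows "graded_derivation 0 L"
proof -
  interpret L: Vector_Spaces.linear "scW C" "scW C" L
    using assms by (simp add: is_lie_derivative_def)
  show ?thesis
    unfolding graded_derivation_def twisted_derivation_def
  proof (intro conjI allI ballI)
    show "\<exists>m. L \<xi> \<in> forms C m \<and> even (m + n + 0)" if "\<xi> \<in> forms C n" for n \<xi>
      using that assms by (intro exI[of _ n]) (auto simp: is_lie_derivative_def)
  qed (use assms in \<open>auto simp: is_lie_derivative_def L.add L.scale\<close>)
qed

text \<open>Two interior products along \<theta> are derivations of equal parity that agree on
  \<open>A\<close> and \<open>dA\<close>, so the description by \<open>THE\<close> has a unique
  solution.\<close>

lemma interior_product_eqI:
  assumes "is_interior_product C \<theta> i"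
  shows "interior_product C \<theta> = i"
  unfolding interior_product_def
proof (rule the_equality, rule assms)
  fix j assume j: "is_interior_product C \<theta> j"
  note D = graded_derivationD[OF graded_derivation_interior]
  show "j = i"
    by (rule twisted_derivation_eqI[OF D[OF j] D[OF assms]])
      (use assms j in \<open>simp_all add: is_interior_product_def\<close>)
qed

lemma lie_derivative_eqI:
  assumes "is_lie_derivative C \<theta> L"
  shows "lie_derivative C \<theta> = L"
  unfolding lie_derivative_def
proof (rule the_equality, rule assms)
  fix M assume M: "is_lie_derivative C \<theta> M"
  note D = graded_derivationD[OF graded_derivation_lie]
  show "M = L"
    by (rule twisted_derivation_eqI[OF D[OF M] D[OF assms]])
      (use assms M in \<open>simp_all add: is_lie_derivative_def\<close>)
qed

lemma is_interior_product_interior_product: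
  "interior_well_defined C \<theta> \<Longrightarrow> is_interior_product C \<theta> (interior_product C \<theta>)"
  by (auto simp: interior_well_defined_def interior_product_eqI)

lemma is_lie_derivative_lie_derivative:
  "lie_well_defined C \<theta> \<Longrightarrow> is_lie_derivative C \<theta> (lie_derivative C \<theta>)"
  by (auto simp: lie_well_defined_def lie_derivative_eqI)

section \<open>The Cartan identities\<close>

lemma emb_minus: "emb C (- a) = - emb C a"
  and emb_diff: "emb C (a - b) = emb C a - emb C b"
proof -
  interpret e: Vector_Spaces.linear "scA C" "scW C" "emb C" by (rule emb_linear)
  show "emb C (- a) = - emb C a" "emb C (a - b) = emb C a - emb C b"
    by (rule e.neg e.diff)+
qed

lemma diff_zero: "diff C 0 = 0"
  by (rule twisted_derivation_zero[OF graded_derivationD[OF graded_derivation_diff]])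

lemma twisted_derivation_zero_map: "twisted_derivation p (\<lambda>x. 0)"
  by (simp add: twisted_derivation_def)

text \<open>The right-hand side is the graded commutator of two odd derivations. It takes a to
  \<theta>(a) because \<open>i\<close> kills \<open>A\<close>, and da to d(\<theta>(a)) because
  \<open>d\<close> squares to zero.\<close>

lemma cartan_formula:
  assumes i: "is_interior_product C \<theta> i" and L: "is_lie_derivative C \<theta> L"
  shows "L x = diff C (i x) + i (diff C x)"
proof -
  have i0: "i 0 = 0"
    by (rule twisted_derivation_zero[OF graded_derivationD[OF graded_derivation_interior[OF i]]])
  have "(\<lambda>x. diff C (i x) - (- 1) ^ (1 * 1) * i (diff C x)) = L"
  proof (rule twisted_derivation_eqI)
    show "twisted_derivation 2 (\<lambda>x. diff C (i x) - (- 1) ^ (1 * 1) * i (diff C x))"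
      using twisted_derivation_commutator[OF graded_derivation_diff graded_derivation_interior[OF i]]
      by (simp add: numeral_2_eq_2)
    \<comment> \<open>The commutator carries the degree 1 + 1; for \<open>L\<close> the degrees 0
      and 2 give the same signs.\<close>
    show "twisted_derivation 2 L"
      using graded_derivationD[OF graded_derivation_lie[OF L]]
      by (simp add: twisted_derivation_def minus_one_power_mult)
  qed (use i L in \<open>simp_all add: is_interior_product_def is_lie_derivative_def
      diff_twice diff_zero i0\<close>)
  from fun_cong[OF this, of x] show ?thesis by simp
qed

text \<open>The graded commutator vanishes on \<open>A\<close>, and on \<open>dA\<close> as well,
  since the inner map sends da into \<open>A\<close>, where the outer one is zero.\<close>

lemma interior_products_anticommute:
  assumes i: "is_interior_product C \<theta> i" and j: "is_interior_product C \<phi> j"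
  shows "i (j x) = - j (i x)"
proof -
  note zero = twisted_derivation_zero[OF graded_derivationD[OF graded_derivation_interior]]
  have "(\<lambda>x. i (j x) - (- 1) ^ (1 * 1) * j (i x)) = (\<lambda>x. 0)"
    by (rule twisted_derivation_eqI[OF twisted_derivation_commutator[OF
          graded_derivation_interior[OF i] graded_derivation_interior[OF j]]
          twisted_derivation_zero_map])
      (use i j in \<open>simp_all add: is_interior_product_def zero[OF i] zero[OF j]\<close>)
  from fun_cong[OF this, of x] show ?thesis by (simp add: eq_neg_iff_add_eq_0)
qed

text \<open>Both sides are odd derivations vanishing on \<open>A\<close>; on da the right-hand side
  is \<theta>(\<phi>(a)) - \<phi>(\<theta>(a)).\<close>

lemma lie_interior_commutator:
  assumes L: "is_lie_derivative C \<theta> L" and i: "is_interior_product C \<phi> i"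
    and k: "is_interior_product C (\<lambda>a. \<theta> (\<phi> a) - \<phi> (\<theta> a)) k"
  shows "k x = L (i x) - i (L x)"
proof -
  have L0: "L 0 = 0"
    by (rule twisted_derivation_zero[OF graded_derivationD[OF graded_derivation_lie[OF L]]])
  have "(\<lambda>x. L (i x) - (- 1) ^ (0 * 1) * i (L x)) = k"
  proof (rule twisted_derivation_eqI)
    show "twisted_derivation 1 (\<lambda>x. L (i x) - (- 1) ^ (0 * 1) * i (L x))"
      using twisted_derivation_commutator[OF graded_derivation_lie[OF L]
          graded_derivation_interior[OF i]]
      by simp
    show "twisted_derivation 1 k"
      by (rule graded_derivationD[OF graded_derivation_interior[OF k]])
  qed (use L i k in \<open>simp_all add: is_interior_product_def is_lie_derivative_def L0 emb_diff\<close>)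
  from fun_cong[OF this, of x] show ?thesis by simp
qed

end

section \<open>Hamiltonian fields and the Poisson bracket\<close>

locale symplectic_calculus = differential_calculus C
  for C :: "('k::field, 'a::{ring, monoid_mult}, 'w::{ring, monoid_mult}) calculus" +
  fixes V :: "('a \<Rightarrow> 'a) set" and \<omega> :: 'w
  assumes lie_algebra: "derivation_lie_algebra C V"
    and interior: "\<theta> \<in> V \<Longrightarrow> interior_well_defined C \<theta>"
    and lie: "\<theta> \<in> V \<Longrightarrow> lie_well_defined C \<theta>"
    and closed: "diff C \<omega> = 0"
    and nonsing: "nonsingular C V \<omega>"
begin

abbreviation "X \<equiv> hamiltonian_field C V \<omega>"

lemma interior_product: "\<theta> \<in> V \<Longrightarrow> is_interior_product C \<theta> (interior_product C \<theta>)"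
  by (intro is_interior_product_interior_product interior)

lemma lie_derivative: "\<theta> \<in> V \<Longrightarrow> is_lie_derivative C \<theta> (lie_derivative C \<theta>)"
  by (intro is_lie_derivative_lie_derivative lie)

lemma interior_product_zero: "\<theta> \<in> V \<Longrightarrow> interior_product C \<theta> 0 = 0"
  by (rule twisted_derivation_zero[OF graded_derivationD[OF
        graded_derivation_interior[OF interior_product]]])

lemma interior_product_diff_emb:
  "\<theta> \<in> V \<Longrightarrow> interior_product C \<theta> (diff C (emb C a)) = emb C (\<theta> a)"
  using interior_product by (simp add: is_interior_product_def)

text \<open>Cartan's formula at \<omega>, whose second term vanishes because \<omega> is
  closed.\<close>

lemma invariant_fields_iff:
  "\<theta> \<in> invariant_fields C V \<omega> \<longleftrightarrow> \<theta> \<in> V \<and> diff C (interior_product C \<theta> \<omega>) = 0"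
  by (auto simp: invariant_fields_def cartan_formula[OF interior_product lie_derivative]
      closed interior_product_zero)

text \<open>Invariance of \<theta> is automatic because da is closed; nonsingularity gives
  uniqueness.\<close>

lemma hamiltonian_field_eqI:
  assumes "\<theta> \<in> V" and "interior_product C \<theta> \<omega> = diff C (emb C a)"
  shows "X a = \<theta>"
  unfolding hamiltonian_field_def
proof (rule the_equality)
  show \<theta>: "\<theta> \<in> invariant_fields C V \<omega> \<and> omega_tilde C \<omega> \<theta> = diff C (emb C a)"
    using assms by (simp add: invariant_fields_iff omega_tilde_def diff_twice)
  fix \<phi> assume "\<phi> \<in> invariant_fields C V \<omega> \<and> omega_tilde C \<omega> \<phi> = diff C (emb C a)"
  with \<theta> nonsing show "\<phi> = \<theta>" by (simp add: nonsingular_def inj_on_def)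
qed

lemma hamiltonian_iff:
  "hamiltonian C V \<omega> a \<longleftrightarrow> (\<exists>\<theta>\<in>V. interior_product C \<theta> \<omega> = diff C (emb C a))"
proof -
  have "hamiltonian C V \<omega> a \<longleftrightarrow>
      (\<exists>\<theta>\<in>invariant_fields C V \<omega>. interior_product C \<theta> \<omega> = diff C (emb C a))"
    unfolding hamiltonian_def omega_tilde_def image_iff by metis
  then show ?thesis
    unfolding Bex_def invariant_fields_iff by (metis diff_twice)
qed

lemma hamiltonian_field:
  assumes "hamiltonian C V \<omega> a"
  shows "X a \<in> V" and "interior_product C (X a) \<omega> = diff C (emb C a)"
  using assms hamiltonian_field_eqI unfolding hamiltonian_iff by auto

text \<open>Contract \<omega> with \<open>X a\<close> and \<open>X b\<close> in both orders: the
  inner contraction gives da or db, the outer one a bracket, and the two orders differ by a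
  sign.\<close>

lemma poisson_antisym:
  assumes a: "hamiltonian C V \<omega> a" and b: "hamiltonian C V \<omega> b"
  shows "X a b = - X b a"
  using interior_products_anticommute[OF interior_product interior_product,
      of "X a" "X b" \<omega>] hamiltonian_field[OF a] hamiltonian_field[OF b]
  by (simp add: interior_product_diff_emb emb_minus[symmetric] emb_inj)

text \<open>By the commutator identity, contracting \<omega> with
  [\<open>X a\<close>, \<open>X b\<close>] gives the Lie derivative along \<open>X a\<close> of db,
  because that of \<omega> vanishes. The result is d(\<open>X a b\<close>), so the commutator is the
  Hamiltonian field of the bracket.\<close>

lemma
  assumes a: "hamiltonian C V \<omega> a" and b: "hamiltonian C V \<omega> b"
  shows hamiltonian_poisson: "hamiltonian C V \<omega> (X a b)"
    and field_poisson: "X (X a b) = (\<lambda>c. X a (X b c) - X b (X a c))"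
proof -
  note a = hamiltonian_field[OF a] and b = hamiltonian_field[OF b]
  let ?\<theta> = "\<lambda>c. X a (X b c) - X b (X a c)"
  have \<theta>: "?\<theta> \<in> V"
    using lie_algebra a(1) b(1) by (simp add: derivation_lie_algebra_def)
  have "lie_derivative C (X a) \<omega> = 0"
    by (simp add: cartan_formula[OF interior_product lie_derivative] a closed
        interior_product_zero diff_twice)
  then have "interior_product C ?\<theta> \<omega> = lie_derivative C (X a) (diff C (emb C b))"
    by (simp add: lie_interior_commutator[OF lie_derivative interior_product interior_product]
        a b \<theta> interior_product_zero)
  also have "\<dots> = diff C (emb C (X a b))"
    using lie_derivative[OF a(1)] by (simp add: is_lie_derivative_def)
  finally have *: "interior_product C ?\<theta> \<omega> = diff C (emb C (X a b))" .
  show "hamiltonian C V \<omega> (X a b)"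
    using \<theta> * by (auto simp: hamiltonian_iff)
  show "X (X a b) = ?\<theta>"
    by (rule hamiltonian_field_eqI[OF \<theta> *])
qed

end

theorem proposition3p4:
  fixes C :: "('k::field, 'a::{ring, monoid_mult}, 'w::{ring, monoid_mult}) calculus"
    and V :: "('a \<Rightarrow> 'a) set" and \<omega> :: 'w and a b c :: 'a
  assumes "differential_calculus C"
    and "derivation_lie_algebra C V"
    and "\<forall>\<theta>\<in>V. interior_well_defined C \<theta>"
    and "\<forall>\<theta>\<in>V. lie_well_defined C \<theta>"
    and "\<omega> \<in> forms C 2" and "diff C \<omega> = 0"
    and "nonsingular C V \<omega>"
    and "hamiltonian C V \<omega> a" and "hamiltonian C V \<omega> b" and "hamiltonian C V \<omega> c"
  shows "poisson_bracket C V \<omega> c (poisson_bracket C V \<omega> a b)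
       + poisson_bracket C V \<omega> b (poisson_bracket C V \<omega> c a)
       + poisson_bracket C V \<omega> a (poisson_bracket C V \<omega> b c) = 0"
proof -
  interpret symplectic_calculus C V \<omega>
    using assms by (simp add: symplectic_calculus_def symplectic_calculus_axioms_def)
  note H = assms(8-10)
  have "derivation C (X b)"
    using lie_algebra hamiltonian_field(1)[OF H(2)] by (simp add: derivation_lie_algebra_def)
  then interpret Xb: Vector_Spaces.linear "scA C" "scA C" "X b"
    by (simp add: derivation_def)
  \<comment> \<open>Antisymmetry moves c into the argument, where the field of {a,b} acts as the
    commutator of \<open>X a\<close> and \<open>X b\<close>.\<close>
  have "X c (X a b) = X b (X a c) - X a (X b c)"
    using poisson_antisym[OF H(3) hamiltonian_poisson[OF H(1,2)]] field_poisson[OF H(1,2)]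
    by simp
  \<comment> \<open>Linearity of the derivation \<open>X b\<close> takes out the sign of {c,a} =
    -{a,c}; the second-order terms in c then cancel.\<close>
  moreover have "X b (X c a) = - X b (X a c)"
    by (simp add: poisson_antisym[OF H(3,1)] Xb.neg)
  ultimately show ?thesis
    by (simp add: poisson_bracket_def)
qed

end
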